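(* Let $F,G:\Omega\to\mathcal{H}$ be norm bounded Bessel mappings for $\mathcal{H}$ with respect to $(\Omega,\mu)$, with norm bounds $L_F$ and $L_G$, respectively. Let $m\in L^1(\Omega,\mu)$. Then $\mathbf{M}_{m,F,G}$ is a well defined bounded operator and a trace class operator with $\|\mathbf{M}_{m,F,G}\|_{\mathcal{S}_1}\le\|m\|_1\,L_F\,L_G$.
   Context: $\mathcal{H}$ is a complex Hilbert space with inner product linear in the first and conjugate linear in the second variable, and $(\Omega,\mu)$ is a measure space with positive measure $\mu$. A mapping $F:\Omega\to\mathcal{H}$ is a Bessel mapping with respect to $(\Omega,\mu)$ with Bessel bound $B_F$ if $\omega\mapsto\langle f,F(\omega)\rangle$ is measurable for every $f\in\mathcal{H}$ and $\int_\Omega|\langle f,F(\omega)\rangle|^2\,d\mu(\omega)\le B_F\|f\|^2$ for all $f\in\mathcal{H}$. It is norm bounded with norm bound $L_F$ if $\|F(\omega)\|\le L_F$ for almost every $\omega\in\Omega$. The continuous Bessel multiplier $\mathbf{M}_{m,F,G}:\mathcal{H}\to\mathcal{H}$ with symbol $m:\Omega\to\mathbb{C}$ (measurable) is the operator weakly defined by $\langle\mathbf{M}_{m,F,G}f,g\rangle=\int_\Omega m(\omega)\langle f,F(\omega)\rangle\langle G(\omega),g\rangle\,d\mu(\omega)$ for all $f,g\in\mathcal{H}$; "well defined" means that the integral exists for all $f,g$ and determines such an operator. $\|\cdot\|_{\mathcal{S}_1}$ is the trace norm (the sum of the singular values). *)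

theory Defs
  imports "HOL-Analysis.Analysis"
begin

text \<open>
  Complex Hilbert spaces. The real inner product of the superclass is the real part of the complex
  one, so that norm, metric and topology are those induced by the complex inner product, which
  is linear in its first and conjugate linear in its second argument. Positive definiteness is
  inherited from the real inner product, see \<open>cinner_self\<close> below.
\<close>

class complex_inner = real_inner +
  fixes scaleC :: "complex \<Rightarrow> 'a \<Rightarrow> 'a" (infixr "*\<^sub>C" 75)
    and cinner :: "'a \<Rightarrow> 'a \<Rightarrow> complex"
  assumes scaleC_add_right: "a *\<^sub>C (x + y) = a *\<^sub>C x + a *\<^sub>C y"
    and scaleC_add_left: "(a + b) *\<^sub>C x = a *\<^sub>C x + b *\<^sub>C x"
    and scaleC_scaleC: "a *\<^sub>C b *\<^sub>C x = (a * b) *\<^sub>C x"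
    and scaleC_of_real: "complex_of_real r *\<^sub>C x = r *\<^sub>R x"
    and cinner_commute: "cinner x y = cnj (cinner y x)"
    and cinner_add_left: "cinner (x + y) z = cinner x z + cinner y z"
    and cinner_scaleC_left: "cinner (a *\<^sub>C x) y = a * cinner x y"
    and Re_cinner: "Re (cinner x y) = inner x y"

class complex_hilbert_space = complex_inner + complete_space

global_interpretation complex_vector:
  vector_space "scaleC :: complex \<Rightarrow> 'a \<Rightarrow> 'a::complex_inner"
proof
  show "1 *\<^sub>C x = x" for x :: 'a
    using scaleC_of_real[of 1 x] by simp
qed (rule scaleC_add_right scaleC_add_left scaleC_scaleC)+

lemma cinner_self: "cinner x x = complex_of_real ((norm x)\<^sup>2)"
  using cinner_commute[of x x]
  by (simp add: complex_eq_iff Re_cinner power2_norm_eq_inner)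

instantiation complex :: complex_hilbert_space
begin

definition scaleC_complex :: "complex \<Rightarrow> complex \<Rightarrow> complex"
  where "scaleC_complex a x = a * x"

definition cinner_complex :: "complex \<Rightarrow> complex \<Rightarrow> complex"
  where "cinner_complex x y = x * cnj y"

instance
  by standard
    (simp_all add: scaleC_complex_def cinner_complex_def algebra_simps scaleR_conv_of_real
      inner_complex_def)

end

definition bounded_clinear :: "('a::complex_inner \<Rightarrow> 'b::complex_inner) \<Rightarrow> bool"
  where "bounded_clinear T \<longleftrightarrow>
    Vector_Spaces.linear scaleC scaleC T \<and> (\<exists>K. \<forall>x. norm (T x) \<le> K * norm x)"

definition compact_operator :: "('a::complex_inner \<Rightarrow> 'b::complex_inner) \<Rightarrow> bool"
  where "compact_operator T \<longleftrightarrow> bounded_clinear T \<and> compact (closure (T ` cball 0 1))"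

definition cadjoint ::
    "('a::complex_hilbert_space \<Rightarrow> 'b::complex_hilbert_space) \<Rightarrow> 'b \<Rightarrow> 'a"
  where "cadjoint T = (THE S. \<forall>x y. cinner (T x) y = cinner x (S y))"

text \<open>
  The singular values of \<open>T\<close> are the nonnegative square roots of the eigenvalues of \<open>T\<^sup>* T\<close>, and
  the multiplicity of \<open>\<sigma>\<close> is the complex dimension of the eigenspace for \<open>\<sigma>\<^sup>2\<close>; it is \<open>0\<close> if
  \<open>\<sigma>\<close> is not a singular value. The library dimension is also \<open>0\<close> for infinite-dimensional
  spaces, but for compact \<open>T\<close> and \<open>\<sigma> > 0\<close> the eigenspace has finite dimension.
\<close>

definition singular_value_multiplicity ::
    "('a::complex_hilbert_space \<Rightarrow> 'b::complex_hilbert_space) \<Rightarrow> real \<Rightarrow> nat"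
  where "singular_value_multiplicity T \<sigma> =
    complex_vector.dim {x. cadjoint T (T x) = complex_of_real (\<sigma>\<^sup>2) *\<^sub>C x}"

text \<open>
  Each singular value is summed as often as its multiplicity. The singular value \<open>0\<close> does not
  contribute, so the sum ranges over the positive reals.
\<close>

definition trace_class ::
    "('a::complex_hilbert_space \<Rightarrow> 'b::complex_hilbert_space) \<Rightarrow> bool"
  where "trace_class T \<longleftrightarrow> compact_operator T \<and>
    (\<lambda>\<sigma>. real (singular_value_multiplicity T \<sigma>) * \<sigma>) summable_on {0<..}"

definition trace_norm ::
    "('a::complex_hilbert_space \<Rightarrow> 'b::complex_hilbert_space) \<Rightarrow> real"
  where "trace_norm T = (\<Sum>\<^sub>\<infinity>\<sigma>\<in>{0<..}. real (singular_value_multiplicity T \<sigma>) * \<sigma>)"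

definition bessel_bound :: "'w measure \<Rightarrow> ('w \<Rightarrow> 'h::complex_hilbert_space) \<Rightarrow> real \<Rightarrow> bool"
  where "bessel_bound \<mu> F B \<longleftrightarrow>
    (\<forall>f. integrable \<mu> (\<lambda>\<omega>. (cmod (cinner f (F \<omega>)))\<^sup>2) \<and>
         (LINT \<omega>|\<mu>. (cmod (cinner f (F \<omega>)))\<^sup>2) \<le> B * (norm f)\<^sup>2)"

definition bessel_mapping :: "'w measure \<Rightarrow> ('w \<Rightarrow> 'h::complex_hilbert_space) \<Rightarrow> bool"
  where "bessel_mapping \<mu> F \<longleftrightarrow>
    (\<forall>f. (\<lambda>\<omega>. cinner f (F \<omega>)) \<in> borel_measurable \<mu>) \<and> (\<exists>B. bessel_bound \<mu> F B)"

definition norm_bound :: "'w measure \<Rightarrow> ('w \<Rightarrow> 'h::complex_hilbert_space) \<Rightarrow> real \<Rightarrow> bool"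
  where "norm_bound \<mu> F L \<longleftrightarrow> (AE \<omega> in \<mu>. norm (F \<omega>) \<le> L)"

definition multiplier_integrand ::
    "('w \<Rightarrow> complex) \<Rightarrow> ('w \<Rightarrow> 'h::complex_hilbert_space) \<Rightarrow> ('w \<Rightarrow> 'h) \<Rightarrow> 'h \<Rightarrow> 'h \<Rightarrow> 'w \<Rightarrow> complex"
  where "multiplier_integrand m F G f g \<omega> = m \<omega> * cinner f (F \<omega>) * cinner (G \<omega>) g"

definition weakly_defines ::
    "'w measure \<Rightarrow> ('w \<Rightarrow> complex) \<Rightarrow> ('w \<Rightarrow> 'h::complex_hilbert_space) \<Rightarrow> ('w \<Rightarrow> 'h)
      \<Rightarrow> ('h \<Rightarrow> 'h) \<Rightarrow> bool"
  where "weakly_defines \<mu> m F G T \<longleftrightarrow>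
    (\<forall>f g. cinner (T f) g = (LINT \<omega>|\<mu>. multiplier_integrand m F G f g \<omega>))"

definition multiplier_well_defined ::
    "'w measure \<Rightarrow> ('w \<Rightarrow> complex) \<Rightarrow> ('w \<Rightarrow> 'h::complex_hilbert_space) \<Rightarrow> ('w \<Rightarrow> 'h) \<Rightarrow> bool"
  where "multiplier_well_defined \<mu> m F G \<longleftrightarrow>
    (\<forall>f g. integrable \<mu> (multiplier_integrand m F G f g)) \<and> (\<exists>!T. weakly_defines \<mu> m F G T)"

definition multiplier ::
    "'w measure \<Rightarrow> ('w \<Rightarrow> complex) \<Rightarrow> ('w \<Rightarrow> 'h::complex_hilbert_space) \<Rightarrow> ('w \<Rightarrow> 'h) \<Rightarrow> 'h \<Rightarrow> 'h"
  where "multiplier \<mu> m F G = (THE T. weakly_defines \<mu> m F G T)"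

end

theory Submission
  imports Defs
begin

text \<open>
  Everything rests on one estimate. For finite orthonormal families \<open>e\<^sub>i\<close> and \<open>f\<^sub>i\<close>,
  Cauchy-Schwarz and Bessel's inequality in \<open>\<H>\<close> give, at almost every \<open>\<omega>\<close>,
  \<open>\<Sum>\<^sub>i \<bar>\<langle>e\<^sub>i, F \<omega>\<rangle>\<bar> \<bar>\<langle>G \<omega>, f\<^sub>i\<rangle>\<bar> \<le> \<parallel>F \<omega>\<parallel> \<parallel>G \<omega>\<parallel> \<le> L\<^sub>F L\<^sub>G\<close>;
  integrating against \<open>\<bar>m\<bar>\<close> bounds the diagonal sums \<open>\<Sum>\<^sub>i \<bar>\<langle>M e\<^sub>i, f\<^sub>i\<rangle>\<bar>\<close> of the multiplier \<open>M\<close>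
  by \<open>C = \<parallel>m\<parallel>\<^sub>1 L\<^sub>F L\<^sub>G\<close> (\<open>diagonal_sums_multiplier_le\<close>). That \<open>M\<close> exists and is bounded is the
  Riesz representation theorem, applied to the bounded sesquilinear form that defines it.

  Any bounded operator \<open>T\<close> whose diagonal sums are bounded by \<open>C\<close> is trace class with trace norm
  at most \<open>C\<close>. For compactness, fix \<open>\<epsilon> > 0\<close> and
  choose orthonormal families with \<open>\<bar>\<langle>T e\<^sub>i, f\<^sub>i\<rangle>\<bar> \<ge> \<epsilon>\<close> that are as long as possible; they have at
  most \<open>C / \<epsilon>\<close> members. If \<open>P\<close> and \<open>Q\<close> are the orthogonal projections onto their spans, maximality
  says \<open>\<parallel>(1 - Q) T (1 - P)\<parallel> \<le> \<epsilon>\<close>, so \<open>T\<close> is within \<open>\<epsilon>\<close> of the finite rank operator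
  \<open>T P + Q T (1 - P)\<close> (\<open>compact_operator_if_diagonal_sums_le\<close>).
  For the trace norm, let \<open>e\<^sub>i\<close> be orthonormal eigenvectors of \<open>T\<^sup>* T\<close> for eigenvalues
  \<open>\<sigma>\<^sub>i\<^sup>2 > 0\<close>. Then the \<open>f\<^sub>i = T e\<^sub>i / \<sigma>\<^sub>i\<close> are orthonormal as well, and \<open>\<langle>T e\<^sub>i, f\<^sub>i\<rangle> = \<sigma>\<^sub>i\<close>, so that every
  finite sum of singular values is a diagonal sum (\<open>sum_singular_values_le\<close>).
\<close>

section \<open>Complex inner products\<close>

lemma cinner_add_right: "cinner x (y + z) = cinner x y + cinner x (z :: 'a::complex_inner)"
  by (metis cinner_add_left cinner_commute complex_cnj_add)

lemma cinner_scaleC_right: "cinner x (a *\<^sub>C y) = cnj a * cinner x (y :: 'a::complex_inner)"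
  by (metis cinner_commute cinner_scaleC_left complex_cnj_mult)

lemma cinner_zero_left [simp]: "cinner 0 (y :: 'a::complex_inner) = 0"
  using cinner_add_left[of 0 0 y] by simp

lemma cinner_zero_right [simp]: "cinner (x :: 'a::complex_inner) 0 = 0"
  using cinner_add_right[of x 0 0] by simp

lemma cinner_diff_left: "cinner (x - y) z = cinner x z - cinner y (z :: 'a::complex_inner)"
  using cinner_add_left[of "x - y" y z] by simp

lemma cinner_diff_right: "cinner x (y - z) = cinner x y - cinner x (z :: 'a::complex_inner)"
  using cinner_add_right[of x "y - z" z] by simp

lemma cinner_sum_left:
  "cinner (\<Sum>i\<in>I. f i) (y :: 'a::complex_inner) = (\<Sum>i\<in>I. cinner (f i) y)"
  by (induction I rule: infinite_finite_induct) (simp_all add: cinner_add_left)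

lemma cinner_sum_right:
  "cinner (x :: 'a::complex_inner) (\<Sum>i\<in>I. f i) = (\<Sum>i\<in>I. cinner x (f i))"
  by (induction I rule: infinite_finite_induct) (simp_all add: cinner_add_right)

lemma norm_scaleC: "norm (a *\<^sub>C x) = cmod a * norm (x :: 'a::complex_inner)"
proof -
  have "complex_of_real ((norm (a *\<^sub>C x))\<^sup>2) = (a * cnj a) * complex_of_real ((norm x)\<^sup>2)"
    unfolding cinner_self[symmetric] by (simp add: cinner_scaleC_left cinner_scaleC_right)
  also have "\<dots> = complex_of_real ((cmod a * norm x)\<^sup>2)"
    by (simp add: power_mult_distrib flip: complex_norm_square)
  finally have "(norm (a *\<^sub>C x))\<^sup>2 = (cmod a * norm x)\<^sup>2"
    using of_real_eq_iff by blast
  then show ?thesis by (simp add: power2_eq_iff_nonneg)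
qed

lemma cinner_eq_zero_iff: "cinner x x = 0 \<longleftrightarrow> x = (0 :: 'a::complex_inner)"
  by (simp add: cinner_self)

lemma cinner_left_eqI:
  assumes "\<And>y. cinner x y = cinner x' (y :: 'a::complex_inner)"
  shows "x = x'"
  using assms cinner_eq_zero_iff[of "x - x'"] by (simp add: cinner_diff_left)

text \<open>Rotating \<open>x\<close> by a phase makes the complex inner product real, so that the real
  Cauchy-Schwarz inequality applies.\<close>

lemma norm_cinner_le: "cmod (cinner x y) \<le> norm x * norm (y :: 'a::complex_inner)"
proof (cases "cinner x y = 0")
  case False
  define a where "a = cnj (sgn (cinner x y))"
  have a: "cmod a = 1"
    using False by (simp add: a_def norm_sgn)
  have "cinner (a *\<^sub>C x) y = complex_of_real (cmod (cinner x y))"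
    using False
    by (simp add: a_def cinner_scaleC_left sgn_eq complex_norm_square[symmetric] power2_eq_square
        field_simps flip: of_real_mult)
  then have "cmod (cinner x y) = inner (a *\<^sub>C x) y"
    using Re_cinner[of "a *\<^sub>C x" y] by simp
  also have "\<dots> \<le> norm (a *\<^sub>C x) * norm y" by (rule norm_cauchy_schwarz)
  finally show ?thesis by (simp add: norm_scaleC a)
qed simp

section \<open>Orthonormal families\<close>

definition orthonormal_on :: "'i set \<Rightarrow> ('i \<Rightarrow> 'a::complex_inner) \<Rightarrow> bool"
  where "orthonormal_on I e \<longleftrightarrow> (\<forall>i\<in>I. \<forall>j\<in>I. cinner (e i) (e j) = (if i = j then 1 else 0))"

definition orthonormal_proj :: "'i set \<Rightarrow> ('i \<Rightarrow> 'a::complex_inner) \<Rightarrow> 'a \<Rightarrow> 'a"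
  where "orthonormal_proj I e x = (\<Sum>i\<in>I. cinner x (e i) *\<^sub>C e i)"

lemma orthonormal_onD:
  assumes "orthonormal_on I e" and "i \<in> I" and "j \<in> I"
  shows "cinner (e i) (e j) = (if i = j then 1 else 0)"
  using assms unfolding orthonormal_on_def by blast

lemma orthonormal_on_norm:
  assumes "orthonormal_on I e" and "i \<in> I"
  shows "norm (e i) = 1"
proof -
  have "complex_of_real ((norm (e i))\<^sup>2) = 1"
    using orthonormal_onD[OF assms assms(2)] by (simp add: cinner_self)
  then have "(norm (e i))\<^sup>2 = 1"
    using of_real_eq_1_iff by blast
  then show ?thesis by (simp add: power2_eq_1_iff) (smt (verit) norm_ge_zero)
qed

lemma orthonormal_on_insert:
  assumes "orthonormal_on I e" and "i \<notin> I" and "norm y = 1"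
    and "\<And>j. j \<in> I \<Longrightarrow> cinner y (e j) = 0"
  shows "orthonormal_on (insert i I) (e(i := y))"
proof -
  have "cinner (e j) y = 0" if "j \<in> I" for j
    using assms(4)[OF that] cinner_commute[of "e j" y] by simp
  moreover have "cinner y y = 1"
    using assms(3) by (simp add: cinner_self)
  ultimately show ?thesis
    using assms unfolding orthonormal_on_def by auto
qed

lemma orthonormal_proj_orthogonal:
  assumes "finite I" and "orthonormal_on I e" and "j \<in> I"
  shows "cinner (x - orthonormal_proj I e x) (e j) = 0"
proof -
  have "cinner (orthonormal_proj I e x) (e j)
      = (\<Sum>i\<in>I. cinner x (e i) * cinner (e i) (e j))"
    by (simp add: orthonormal_proj_def cinner_sum_left cinner_scaleC_left)
  also have "\<dots> = (\<Sum>i\<in>I. if i = j then cinner x (e j) else 0)"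
    using assms by (intro sum.cong) (auto simp: orthonormal_onD)
  also have "\<dots> = cinner x (e j)"
    using assms by simp
  finally show ?thesis by (simp add: cinner_diff_left)
qed

lemma cinner_orthonormal_proj_eq_zero:
  assumes "\<And>j. j \<in> I \<Longrightarrow> cinner y (e j) = 0"
  shows "cinner y (orthonormal_proj I e x) = 0"
  using assms by (simp add: orthonormal_proj_def cinner_sum_right cinner_scaleC_right)

lemma orthonormal_pythagoras:
  fixes x :: "'a::complex_inner"
  assumes "finite I" and "orthonormal_on I e"
  shows "(norm x)\<^sup>2 = (\<Sum>i\<in>I. (cmod (cinner x (e i)))\<^sup>2) + (norm (x - orthonormal_proj I e x))\<^sup>2"
proof -
  let ?p = "orthonormal_proj I e x"
  have xp: "cinner x ?p = (\<Sum>i\<in>I. complex_of_real ((cmod (cinner x (e i)))\<^sup>2))"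
    by (simp add: orthonormal_proj_def cinner_sum_right cinner_scaleC_right
        complex_norm_square[symmetric] mult.commute flip: of_real_power)
  have "cinner (x - ?p) ?p = 0"
    using orthonormal_proj_orthogonal[OF assms] by (rule cinner_orthonormal_proj_eq_zero)
  then have "cinner x x = cinner x ?p + cinner (x - ?p) (x - ?p) + cnj (cinner (x - ?p) ?p)"
    using cinner_commute[of ?p "x - ?p"] by (simp add: cinner_diff_left cinner_diff_right)
  then have "cinner x x = cinner x ?p + cinner (x - ?p) (x - ?p)"
    using \<open>cinner (x - ?p) ?p = 0\<close> by simp
  then have "complex_of_real ((norm x)\<^sup>2)
      = complex_of_real ((\<Sum>i\<in>I. (cmod (cinner x (e i)))\<^sup>2) + (norm (x - ?p))\<^sup>2)"
    by (simp add: cinner_self xp)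
  then show ?thesis using of_real_eq_iff by blast
qed

lemma bessel_inequality:
  fixes x :: "'a::complex_inner"
  assumes "finite I" and "orthonormal_on I e"
  shows "(\<Sum>i\<in>I. (cmod (cinner x (e i)))\<^sup>2) \<le> (norm x)\<^sup>2"
  using orthonormal_pythagoras[OF assms, of x] by simp

lemma norm_diff_orthonormal_proj_le:
  fixes x :: "'a::complex_inner"
  assumes "finite I" and "orthonormal_on I e"
  shows "norm (x - orthonormal_proj I e x) \<le> norm x"
proof -
  have "0 \<le> (\<Sum>i\<in>I. (cmod (cinner x (e i)))\<^sup>2)"
    by (simp add: sum_nonneg)
  then have "(norm (x - orthonormal_proj I e x))\<^sup>2 \<le> (norm x)\<^sup>2"
    using orthonormal_pythagoras[OF assms, of x] by linarith
  then show ?thesis by (rule power2_le_imp_le) simp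
qed

text \<open>Cauchy-Schwarz in \<open>\<ell>\<^sup>2\<close>, with Bessel's inequality for either factor.\<close>

lemma sum_cinner_mult_le:
  fixes x :: "'a::complex_inner" and y :: "'b::complex_inner"
  assumes "finite I" and "orthonormal_on I e" and "orthonormal_on I f"
  shows "(\<Sum>i\<in>I. cmod (cinner x (e i)) * cmod (cinner y (f i))) \<le> norm x * norm y"
proof -
  have "(\<Sum>i\<in>I. cmod (cinner x (e i)) * cmod (cinner y (f i)))
      \<le> L2_set (\<lambda>i. cmod (cinner x (e i))) I * L2_set (\<lambda>i. cmod (cinner y (f i))) I"
    using L2_set_mult_ineq[of "\<lambda>i. cmod (cinner x (e i))" "\<lambda>i. cmod (cinner y (f i))" I] by simp
  also have "\<dots> \<le> norm x * norm y"
    using bessel_inequality[OF assms(1,2), of x] bessel_inequality[OF assms(1,3), of y]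
    by (intro mult_mono) (auto simp: L2_set_def sum_nonneg intro: real_le_lsqrt)
  finally show ?thesis .
qed

text \<open>Gram-Schmidt: a vector outside the span of the family built so far, minus its projection,
  is a new orthogonal direction.\<close>

lemma orthonormal_subset_of_subspace:
  fixes V :: "'a::complex_inner set"
  assumes V: "complex_vector.subspace V" and "k \<le> complex_vector.dim V"
  shows "\<exists>E\<subseteq>V. finite E \<and> card E = k \<and> orthonormal_on E (\<lambda>x. x)"
  using assms(2)
proof (induction k)
  case 0
  show ?case by (rule exI[of _ "{}"]) (simp add: orthonormal_on_def)
next
  case (Suc k)
  then obtain E where E: "E \<subseteq> V" "finite E" "card E = k" "orthonormal_on E (\<lambda>x. x)"
    by auto
  have "\<not> V \<subseteq> complex_vector.span E"
    using complex_vector.dim_le_card[of V E] E Suc.prems by auto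
  then obtain v where v: "v \<in> V" "v \<notin> complex_vector.span E" by auto
  let ?p = "orthonormal_proj E (\<lambda>x. x) v"
  have pE: "?p \<in> complex_vector.span E"
    unfolding orthonormal_proj_def
    by (intro complex_vector.span_sum complex_vector.span_scale complex_vector.span_base)
  then have pV: "?p \<in> V"
    using complex_vector.span_minimal[OF E(1) V] by auto
  define w where "w = complex_of_real (inverse (norm (v - ?p))) *\<^sub>C (v - ?p)"
  have "v \<noteq> ?p" using v(2) pE by metis
  then have w1: "norm w = 1" by (simp add: w_def norm_scaleC norm_inverse)
  have wV: "w \<in> V"
    unfolding w_def using V v(1) pV
    by (intro complex_vector.subspace_scale complex_vector.subspace_diff)
  have w0: "cinner w x = 0" if "x \<in> E" for x
    using orthonormal_proj_orthogonal[OF E(2,4) that]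
    by (simp add: w_def cinner_scaleC_left)
  have "w \<notin> E"
    using w0[of w] w1 by (auto simp: cinner_self)
  then have "orthonormal_on (insert w E) ((\<lambda>x. x)(w := w))"
    by (intro orthonormal_on_insert E w1 w0)
  then show ?case
    using E wV \<open>w \<notin> E\<close> by (intro exI[of _ "insert w E"]) (simp add: fun_upd_idem)
qed

section \<open>Riesz representation and adjoints\<close>

text \<open>The representing vector is the minimiser of \<open>J x = \<parallel>x\<parallel>\<^sup>2 - 2 \<phi> x\<close>. By the
  parallelogram law \<open>\<parallel>x - y\<parallel>\<^sup>2 = 2 J x + 2 J y - 4 J ((x + y) / 2)\<close>, so minimising
  sequences are Cauchy, and the first variation of \<open>J\<close> at the minimum must vanish.\<close>

theorem riesz_representation_real:
  fixes \<phi> :: "'a::{real_inner,complete_space} \<Rightarrow> real"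
  assumes "bounded_linear \<phi>"
  shows "\<exists>u. \<forall>x. \<phi> x = inner u x"
proof -
  interpret bounded_linear \<phi> by fact
  obtain K where K: "\<And>x. norm (\<phi> x) \<le> norm x * K"
    using bounded by blast
  define J where "J x = (norm x)\<^sup>2 - 2 * \<phi> x" for x
  have J_ge: "- K\<^sup>2 \<le> J x" for x
    using K[of x] sum_power2_ge_zero[of "norm x - K" 0]
    by (simp add: J_def power2_diff)
  then have bdd: "bdd_below (range J)" by (intro bdd_belowI[of _ "- K\<^sup>2"]) auto
  define d where "d = (INF x. J x)"
  have d_le: "d \<le> J x" for x
    unfolding d_def using bdd by (intro cINF_lower) auto
  have "\<exists>x. J x < d + inverse (real (Suc n))" for n
    using cINF_less_iff[OF _ bdd, of "d + inverse (real (Suc n))"] by (auto simp: d_def)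
  then obtain X where X: "\<And>n. J (X n) < d + inverse (real (Suc n))" by metis
  have parallelogram: "(norm (x - y))\<^sup>2 \<le> 2 * (J x - d) + 2 * (J y - d)" for x y
  proof -
    have "(norm (x - y))\<^sup>2 = 2 * J x + 2 * J y - 4 * J ((1/2) *\<^sub>R (x + y))"
      by (simp add: J_def power2_norm_eq_inner algebra_simps inner_simps inner_commute scale add)
    then show ?thesis using d_le[of "(1/2) *\<^sub>R (x + y)"] by simp
  qed
  have "Cauchy X"
  proof (rule metric_CauchyI)
    fix \<epsilon> :: real assume "0 < \<epsilon>"
    then obtain N where N: "inverse (real (Suc N)) < \<epsilon>\<^sup>2 / 4"
      using reals_Archimedean[of "\<epsilon>\<^sup>2 / 4"] by auto
    have small: "J (X n) - d < \<epsilon>\<^sup>2 / 4" if "N \<le> n" for n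
    proof -
      have "inverse (real (Suc n)) \<le> inverse (real (Suc N))"
        using that by (intro le_imp_inverse_le) auto
      then show ?thesis using X[of n] N by linarith
    qed
    have "dist (X k) (X n) < \<epsilon>" if "N \<le> k" "N \<le> n" for k n
    proof -
      have "(norm (X k - X n))\<^sup>2 < \<epsilon>\<^sup>2"
        using parallelogram[of "X k" "X n"] small[OF that(1)] small[OF that(2)]
        by (simp add: field_simps)
      then show ?thesis
        using \<open>0 < \<epsilon>\<close> by (auto simp: dist_norm intro: power2_less_imp_less)
    qed
    then show "\<exists>M. \<forall>k\<ge>M. \<forall>n\<ge>M. dist (X k) (X n) < \<epsilon>" by blast
  qed
  then obtain u where u: "X \<longlonglongrightarrow> u"
    using Cauchy_convergent by (auto simp: convergent_def)
  have "J u \<le> d"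
  proof (rule tendsto_le)
    show "(\<lambda>n. J (X n)) \<longlonglongrightarrow> J u"
      unfolding J_def by (intro tendsto_intros tendsto u)
    show "(\<lambda>n. d + inverse (real (Suc n))) \<longlonglongrightarrow> d"
      using tendsto_add[OF tendsto_const LIMSEQ_inverse_real_of_nat] by force
    show "\<forall>\<^sub>F n in sequentially. J (X n) \<le> d + inverse (real (Suc n))"
      using X by (intro always_eventually) (auto intro: less_imp_le)
  qed simp
  then have minimal: "J u \<le> J x" for x
    using d_le[of x] by linarith
  have "\<phi> x = inner u x" for x
  proof (cases "x = 0")
    case False
    define a where "a = inner u x - \<phi> x"
    have variation: "0 \<le> 2 * t * a + t\<^sup>2 * (norm x)\<^sup>2" for t
    proof -
      have "J (u + t *\<^sub>R x) = J u + 2 * t * a + t\<^sup>2 * (norm x)\<^sup>2"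
        unfolding J_def a_def power2_norm_eq_inner
        by (simp add: algebra_simps inner_simps inner_commute scale add power2_eq_square)
      then show ?thesis using minimal[of "u + t *\<^sub>R x"] by linarith
    qed
    \<comment> \<open>the step length that minimises the quadratic in \<open>t\<close>\<close>
    from variation[of "- a / (norm x)\<^sup>2"] have "0 \<le> - (a\<^sup>2 / (norm x)\<^sup>2)"
      using False by (simp add: field_simps power2_eq_square)
    then have "a\<^sup>2 / (norm x)\<^sup>2 = 0"
      by (intro antisym) auto
    then have "a = 0" using False by simp
    then show ?thesis by (simp add: a_def)
  qed (simp add: zero)
  then show ?thesis by blast
qed

text \<open>Since \<open>Im z = Re (- \<i> z)\<close>, a conjugate linear functional is determined by its real part,
  and so is \<open>cinner u\<close>.\<close>

theorem riesz_representation: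
  fixes \<phi> :: "'a::complex_hilbert_space \<Rightarrow> complex"
  assumes add: "\<And>x y. \<phi> (x + y) = \<phi> x + \<phi> y"
    and scale: "\<And>a x. \<phi> (a *\<^sub>C x) = cnj a * \<phi> x"
    and bound: "\<And>x. cmod (\<phi> x) \<le> K * norm x"
  shows "\<exists>u. \<forall>x. cinner u x = \<phi> x"
proof -
  have "bounded_linear (\<lambda>x. Re (\<phi> x))"
  proof (rule bounded_linear_intro[where K = K])
    show "Re (\<phi> (x + y)) = Re (\<phi> x) + Re (\<phi> y)" for x y by (simp add: add)
    show "Re (\<phi> (r *\<^sub>R x)) = r *\<^sub>R Re (\<phi> x)" for r x
      by (simp add: scale flip: scaleC_of_real)
    show "norm (Re (\<phi> x)) \<le> norm x * K" for x
      using abs_Re_le_cmod[of "\<phi> x"] bound[of x] by (simp add: mult.commute)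
  qed
  then obtain u where u: "\<And>x. Re (\<phi> x) = inner u x"
    using riesz_representation_real by blast
  have "cinner u x = \<phi> x" for x
    using u[of x] u[of "\<i> *\<^sub>C x"]
    by (simp add: complex_eq_iff scale cinner_scaleC_right flip: Re_cinner)
  then show ?thesis by blast
qed

lemma bounded_clinear_add: "bounded_clinear T \<Longrightarrow> T (x + y) = T x + T y"
  unfolding bounded_clinear_def Vector_Spaces.linear_def module_hom_def module_hom_axioms_def
  by blast

lemma bounded_clinear_scaleC: "bounded_clinear T \<Longrightarrow> T (a *\<^sub>C x) = a *\<^sub>C T x"
  unfolding bounded_clinear_def Vector_Spaces.linear_def module_hom_def module_hom_axioms_def
  by blast

lemma bounded_clinear_zero: "bounded_clinear T \<Longrightarrow> T 0 = 0"
  using bounded_clinear_add[of T 0 0] by simp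

lemma bounded_clinear_diff: "bounded_clinear T \<Longrightarrow> T (x - y) = T x - T y"
  using bounded_clinear_add[of T "x - y" y] by simp

lemma bounded_clinear_sum:
  "bounded_clinear T \<Longrightarrow> T (\<Sum>i\<in>I. f i) = (\<Sum>i\<in>I. T (f i))"
  by (induction I rule: infinite_finite_induct)
    (simp_all add: bounded_clinear_zero bounded_clinear_add)

lemma bounded_clinearI:
  assumes "\<And>x y. T (x + y) = T x + T y" and "\<And>a x. T (a *\<^sub>C x) = a *\<^sub>C T x"
    and "\<And>x. norm (T x) \<le> K * norm x"
  shows "bounded_clinear T"
  unfolding bounded_clinear_def
proof
  show "Vector_Spaces.linear scaleC scaleC T"
    by unfold_locales (simp_all add: assms(1,2))
  show "\<exists>K. \<forall>x. norm (T x) \<le> K * norm x" using assms(3) by blast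
qed

lemma cinner_cadjoint:
  fixes T :: "'a::complex_hilbert_space \<Rightarrow> 'b::complex_hilbert_space"
  assumes T: "bounded_clinear T"
  shows "cinner (T x) y = cinner x (cadjoint T y)"
proof -
  obtain K where K: "\<And>x. norm (T x) \<le> K * norm x"
    using T unfolding bounded_clinear_def by blast
  have "\<exists>u. \<forall>x. cinner u x = cinner y (T x)" for y
  proof (rule riesz_representation)
    show "cmod (cinner y (T x)) \<le> (norm y * K) * norm x" for x
      using norm_cinner_le[of y "T x"] mult_left_mono[OF K[of x], of "norm y"]
      by (simp add: mult.assoc)
  qed (simp_all add: bounded_clinear_add[OF T] bounded_clinear_scaleC[OF T] cinner_add_right
      cinner_scaleC_right)
  then obtain S where S: "\<And>x y. cinner (S y) x = cinner y (T x)" by metis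
  have adj: "\<forall>x y. cinner (T x) y = cinner x (S y)"
    unfolding cinner_commute[of "T _"] cinner_commute[of _ "S _"] S by simp
  have "cadjoint T = S"
    unfolding cadjoint_def
  proof (rule the_equality)
    show "\<forall>x y. cinner (T x) y = cinner x (S y)" by (rule adj)
  next
    fix S' assume adj': "\<forall>x y. cinner (T x) y = cinner x (S' y)"
    show "S' = S"
    proof (rule ext, rule cinner_left_eqI)
      fix y x
      have "cinner x (S' y) = cinner x (S y)"
        using adj'[rule_format, of x y] adj[rule_format, of x y] by (rule trans[OF sym])
      then show "cinner (S' y) x = cinner (S y) x"
        using cinner_commute[of "S' y" x] cinner_commute[of "S y" x] by simp
    qed
  qed
  then show ?thesis using adj by blast
qed


section \<open>Bounded diagonal sums force a trace class operator\<close>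

text \<open>The first family is indexed by itself: \<open>E\<close> is an orthonormal set, and \<open>f\<close> assigns to
  each of its members a partner in the second orthonormal family.\<close>

definition diagonal_sums_le :: "('a::complex_inner \<Rightarrow> 'b::complex_inner) \<Rightarrow> real \<Rightarrow> bool"
  where "diagonal_sums_le T C \<longleftrightarrow>
    (\<forall>E f. finite E \<and> orthonormal_on E (\<lambda>x. x) \<and> orthonormal_on E f
      \<longrightarrow> (\<Sum>x\<in>E. cmod (cinner (T x) (f x))) \<le> C)"

text \<open>Finite \<open>\<epsilon>\<close>-nets of the nearby compact sets are nets of \<open>S\<close>, so \<open>S\<close> is totally
  bounded.\<close>

lemma compact_closure_if_near_compact:
  fixes S :: "'a::complete_space set"
  assumes "\<And>\<epsilon>. 0 < \<epsilon> \<Longrightarrow> \<exists>K. compact K \<and> (\<forall>y\<in>S. \<exists>z\<in>K. dist z y \<le> \<epsilon>)"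
  shows "compact (closure S)"
  unfolding compact_eq_totally_bounded
proof (intro conjI allI impI)
  show "complete (closure S)"
    by (simp add: complete_eq_closed)
  fix \<epsilon> :: real assume "0 < \<epsilon>"
  then obtain K where K: "compact K" "\<forall>y\<in>S. \<exists>z\<in>K. dist z y \<le> \<epsilon> / 4"
    using assms[of "\<epsilon> / 4"] by auto
  then obtain N where N: "finite N" "K \<subseteq> (\<Union>x\<in>N. ball x (\<epsilon> / 4))"
    using \<open>0 < \<epsilon>\<close> unfolding compact_eq_totally_bounded by (meson divide_pos_pos zero_less_numeral)
  have "S \<subseteq> (\<Union>x\<in>N. cball x (\<epsilon> / 2))"
  proof
    fix y assume "y \<in> S"
    then obtain z where z: "z \<in> K" "dist z y \<le> \<epsilon> / 4" using K(2) by blast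
    then obtain x where x: "x \<in> N" "dist x z < \<epsilon> / 4" using N(2) by auto
    then have "dist x y \<le> \<epsilon> / 2"
      using dist_triangle[of x y z] z(2) by linarith
    then show "y \<in> (\<Union>x\<in>N. cball x (\<epsilon> / 2))" using x(1) by auto
  qed
  then have "closure S \<subseteq> (\<Union>x\<in>N. cball x (\<epsilon> / 2))"
    using N(1) by (intro closure_minimal closed_UN) auto
  also have "\<dots> \<subseteq> (\<Union>x\<in>N. ball x \<epsilon>)"
    using \<open>0 < \<epsilon>\<close> by (intro UN_mono) auto
  finally show "\<exists>k. finite k \<and> closure S \<subseteq> (\<Union>x\<in>k. ball x \<epsilon>)" using N(1) by blast
qed

text \<open>A finite rank operator maps the unit ball into a set of linear combinations with bounded
  coefficients, a finite sum of compact discs.\<close>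

lemma bounded_combinations_in_compact:
  fixes v :: "'i \<Rightarrow> 'a::complex_inner"
  assumes "finite I"
  shows "\<exists>K. compact K \<and> (\<forall>c. (\<forall>i\<in>I. cmod (c i) \<le> B) \<longrightarrow> (\<Sum>i\<in>I. c i *\<^sub>C v i) \<in> K)"
  using assms
proof (induction I)
  case empty
  show ?case by (rule exI[of _ "{0}"]) simp
next
  case (insert i I)
  then obtain K where K: "compact K"
      "\<And>c. \<forall>i\<in>I. cmod (c i) \<le> B \<Longrightarrow> (\<Sum>i\<in>I. c i *\<^sub>C v i) \<in> K"
    by blast
  let ?D = "(\<lambda>a. a *\<^sub>C v i) ` cball 0 B"
  have "bounded_linear (\<lambda>a. a *\<^sub>C v i)"
  proof (rule bounded_linear_intro)
    show "(r *\<^sub>R a) *\<^sub>C v i = r *\<^sub>R (a *\<^sub>C v i)" for r a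
      by (simp add: scaleC_scaleC scaleR_conv_of_real flip: scaleC_of_real)
    show "norm (a *\<^sub>C v i) \<le> norm a * norm (v i)" for a by (simp add: norm_scaleC)
  qed (rule scaleC_add_left)
  then have "compact ?D"
    by (intro compact_continuous_image linear_continuous_on) auto
  then have "compact {x + y | x y. x \<in> ?D \<and> y \<in> K}"
    using K(1) by (rule compact_sums)
  moreover have "(\<Sum>j\<in>insert i I. c j *\<^sub>C v j) \<in> {x + y | x y. x \<in> ?D \<and> y \<in> K}"
    if "\<forall>j\<in>insert i I. cmod (c j) \<le> B" for c
  proof -
    have "c i *\<^sub>C v i \<in> ?D" using that by auto
    then show ?thesis using that K(2)[of c] insert.hyps by auto
  qed
  ultimately show ?case by blast
qed

text \<open>Pairs with diagonal entries of modulus at least \<open>\<epsilon>\<close> are at most \<open>C / \<epsilon>\<close> in number, so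
  a maximal such family exists. Between unit vectors orthogonal to its two spans all entries of
  \<open>T\<close> are below \<open>\<epsilon>\<close>, hence \<open>T\<close> is \<open>\<epsilon>\<close>-close to a finite rank operator.\<close>

lemma compact_operator_if_diagonal_sums_le:
  fixes T :: "'a::complex_inner \<Rightarrow> 'b::complex_hilbert_space"
  assumes T: "bounded_clinear T" and C: "diagonal_sums_le T C"
  shows "compact_operator T"
  unfolding compact_operator_def
proof (intro conjI T compact_closure_if_near_compact)
  fix \<epsilon> :: real assume \<epsilon>: "0 < \<epsilon>"
  define admissible where "admissible E f \<longleftrightarrow> finite E \<and> orthonormal_on E (\<lambda>x. x) \<and>
    orthonormal_on E f \<and> (\<forall>x\<in>E. \<epsilon> \<le> cmod (cinner (T x) (f x)))" for E :: "'a set" and f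
  have card_le: "card E \<le> nat \<lfloor>C / \<epsilon>\<rfloor>" if "admissible E f" for E f
  proof -
    have "real (card E) * \<epsilon> \<le> (\<Sum>x\<in>E. cmod (cinner (T x) (f x)))"
      using that sum_bounded_below[of E \<epsilon>] by (simp add: admissible_def)
    also have "\<dots> \<le> C"
      using that C by (simp add: admissible_def diagonal_sums_le_def)
    finally have "real (card E) \<le> C / \<epsilon>" using \<epsilon> by (simp add: field_simps)
    then show ?thesis by linarith
  qed
  have "\<exists>E. (\<exists>f. admissible E f) \<and> (\<forall>E'. (\<exists>f. admissible E' f) \<longrightarrow> card E' \<le> card E)"
  proof (rule ex_has_greatest_nat)
    show "\<exists>f. admissible {} f"
      by (simp add: admissible_def orthonormal_on_def)
    show "\<forall>E. (\<exists>f. admissible E f) \<longrightarrow> card E < Suc (nat \<lfloor>C / \<epsilon>\<rfloor>)"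
      using card_le by (auto simp: less_Suc_eq_le)
  qed
  then obtain E f where f: "admissible E f" and
    maximal: "\<And>E' f'. admissible E' f' \<Longrightarrow> card E' \<le> card E"
    by blast
  then have E: "finite E" "orthonormal_on E (\<lambda>x. x)" "orthonormal_on E f"
    by (auto simp: admissible_def)
  \<comment> \<open>otherwise the normalised pair \<open>u\<close>, \<open>w\<close> could be added to the maximal family\<close>
  have small: "cmod (cinner (T u) w) \<le> \<epsilon> * norm u * norm w"
    if u: "\<And>x. x \<in> E \<Longrightarrow> cinner u x = 0" and w: "\<And>x. x \<in> E \<Longrightarrow> cinner w (f x) = 0" for u w
  proof (cases "u = 0 \<or> w = 0")
    case True
    then show ?thesis by (auto simp: bounded_clinear_zero[OF T])
  next
    case False
    define u' where "u' = complex_of_real (inverse (norm u)) *\<^sub>C u"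
    define w' where "w' = complex_of_real (inverse (norm w)) *\<^sub>C w"
    have 1: "norm u' = 1" "norm w' = 1"
      using False by (simp_all add: u'_def w'_def norm_scaleC norm_inverse)
    have 0: "cinner u' x = 0" "cinner w' (f x) = 0" if "x \<in> E" for x
      using u w that by (simp_all add: u'_def w'_def cinner_scaleC_left)
    have "u' \<notin> E"
      using 0(1)[of u'] 1 by (auto simp: cinner_self)
    have "\<not> \<epsilon> \<le> cmod (cinner (T u') w')"
    proof
      assume large: "\<epsilon> \<le> cmod (cinner (T u') w')"
      have "orthonormal_on (insert u' E) ((\<lambda>x. x)(u' := u'))"
        "orthonormal_on (insert u' E) (f(u' := w'))"
        by (rule orthonormal_on_insert[OF E(2) \<open>u' \<notin> E\<close> 1(1) 0(1)]
            orthonormal_on_insert[OF E(3) \<open>u' \<notin> E\<close> 1(2) 0(2)]; assumption)+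
      then have "admissible (insert u' E) (f(u' := w'))"
        using f large \<open>u' \<notin> E\<close> unfolding admissible_def by (simp add: fun_upd_idem)
      then show False
        using maximal[of "insert u' E"] E(1) \<open>u' \<notin> E\<close> by simp
    qed
    then have "inverse (norm w) * (inverse (norm u) * cmod (cinner (T u) w)) < \<epsilon>"
      by (simp add: u'_def w'_def bounded_clinear_scaleC[OF T] cinner_scaleC_left cinner_scaleC_right
          norm_mult norm_inverse)
    then show ?thesis using False by (simp add: field_simps)
  qed
  let ?P = "orthonormal_proj E (\<lambda>x. x)" and ?Q = "orthonormal_proj E f"
  have near: "norm (T (x - ?P x) - ?Q (T (x - ?P x))) \<le> \<epsilon> * norm x" for x
  proof -
    define u where "u = x - ?P x"
    define w where "w = T u - ?Q (T u)"
    have u: "cinner u y = 0" and w: "cinner w (f y) = 0" if "y \<in> E" for y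
      using orthonormal_proj_orthogonal[OF E(1,2) that] orthonormal_proj_orthogonal[OF E(1,3) that]
      by (simp_all add: u_def w_def)
    have "cinner w (?Q (T u)) = 0"
      using w by (rule cinner_orthonormal_proj_eq_zero)
    then have "cinner w (T u) = cinner w w"
      by (simp add: w_def cinner_diff_right)
    then have "cinner (T u) w = cinner w w"
      using cinner_commute[of "T u" w] cinner_commute[of w w] by simp
    then have "norm w * norm w \<le> \<epsilon> * norm u * norm w"
      using small[OF u w] by (simp add: cinner_self norm_mult power2_eq_square)
    then have "norm w \<le> \<epsilon> * norm u"
      using \<epsilon> by (cases "w = 0") auto
    also have "\<dots> \<le> \<epsilon> * norm x"
      using \<epsilon> norm_diff_orthonormal_proj_le[OF E(1,2), of x] by (simp add: u_def)
    finally show ?thesis by (simp add: w_def u_def)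
  qed
  \<comment> \<open>the finite rank approximation is \<open>T P + Q T (1 - P)\<close>; each summand sends the unit ball into
    a compact set\<close>
  obtain B where B: "\<And>x. norm (T x) \<le> B * norm x"
    using T unfolding bounded_clinear_def by blast
  obtain K1 where K1: "compact K1"
      "\<And>c. \<forall>x\<in>E. cmod (c x) \<le> 1 \<Longrightarrow> (\<Sum>x\<in>E. c x *\<^sub>C T x) \<in> K1"
    using bounded_combinations_in_compact[OF E(1), of 1 T] by blast
  obtain K2 where K2: "compact K2"
      "\<And>c. \<forall>x\<in>E. cmod (c x) \<le> \<bar>B\<bar> \<Longrightarrow> (\<Sum>x\<in>E. c x *\<^sub>C f x) \<in> K2"
    using bounded_combinations_in_compact[OF E(1), of "\<bar>B\<bar>" f] by blast
  show "\<exists>K. compact K \<and> (\<forall>y\<in>T ` cball 0 1. \<exists>z\<in>K. dist z y \<le> \<epsilon>)"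
  proof (intro exI conjI ballI)
    show "compact {a + b | a b. a \<in> K1 \<and> b \<in> K2}"
      using K1(1) K2(1) by (rule compact_sums)
    fix y assume "y \<in> T ` cball 0 1"
    then obtain x where x: "y = T x" "norm x \<le> 1" by auto
    define u where "u = x - ?P x"
    have "cmod (cinner x e) \<le> 1" if "e \<in> E" for e
      using norm_cinner_le[of x e] orthonormal_on_norm[OF E(2) that] x(2) by simp
    then have "T (?P x) \<in> K1"
      using K1(2)[of "cinner x"]
      by (simp add: orthonormal_proj_def bounded_clinear_sum[OF T] bounded_clinear_scaleC[OF T])
    moreover have "?Q (T u) \<in> K2"
      unfolding orthonormal_proj_def
    proof (rule K2(2), rule ballI)
      fix e assume "e \<in> E"
      have "cmod (cinner (T u) (f e)) \<le> norm (T u)"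
        using norm_cinner_le[of "T u" "f e"] orthonormal_on_norm[OF E(3) \<open>e \<in> E\<close>] by simp
      also have "\<dots> \<le> \<bar>B\<bar> * norm u"
        using B[of u] mult_right_mono[OF abs_ge_self[of B] norm_ge_zero[of u]] by linarith
      also have "\<dots> \<le> \<bar>B\<bar>"
        using norm_diff_orthonormal_proj_le[OF E(1,2), of x] x(2) mult_left_mono[of "norm u" 1 "\<bar>B\<bar>"]
        by (simp add: u_def)
      finally show "cmod (cinner (T u) (f e)) \<le> \<bar>B\<bar>" .
    qed
    ultimately have "T (?P x) + ?Q (T u) \<in> {a + b | a b. a \<in> K1 \<and> b \<in> K2}" by blast
    moreover have "dist (T (?P x) + ?Q (T u)) y \<le> \<epsilon>"
    proof -
      have "y - (T (?P x) + ?Q (T u)) = T u - ?Q (T u)"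
        by (simp add: x(1) u_def bounded_clinear_diff[OF T])
      then have "dist (T (?P x) + ?Q (T u)) y \<le> \<epsilon> * norm x"
        using near[of x] unfolding dist_commute[of _ y] dist_norm[of y] u_def
        by (simp only:)
      also have "\<dots> \<le> \<epsilon>"
        using \<epsilon> x(2) by (simp add: mult_left_le)
      finally show ?thesis .
    qed
    ultimately show "\<exists>z\<in>{a + b | a b. a \<in> K1 \<and> b \<in> K2}. dist z y \<le> \<epsilon>" by blast
  qed
qed

text \<open>Testing the eigenvector equation against all \<open>y\<close> eliminates the adjoint.\<close>

lemma cadjoint_eigenspace_eq:
  fixes T :: "'a::complex_hilbert_space \<Rightarrow> 'b::complex_hilbert_space"
  assumes "bounded_clinear T"
  shows "{x. cadjoint T (T x) = c *\<^sub>C x} = {x. \<forall>y. cinner (T x) (T y) = c * cinner x y}"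
proof -
  have "cadjoint T (T x) = c *\<^sub>C x \<longleftrightarrow> (\<forall>y. cinner (T x) (T y) = c * cinner x y)" for x
  proof -
    have "cinner (cadjoint T (T x)) y = cinner (T x) (T y)" for y
      using cinner_cadjoint[OF assms, of y "T x"] cinner_commute[of "T x" "T y"]
        cinner_commute[of "cadjoint T (T x)" y] by simp
    then show ?thesis
      using cinner_left_eqI[of "cadjoint T (T x)" "c *\<^sub>C x"] by (auto simp: cinner_scaleC_left)
  qed
  then show ?thesis by blast
qed

text \<open>Orthonormal bases of the eigenspaces of \<open>T\<^sup>* T\<close> combine to one orthonormal set, because
  eigenvectors for different eigenvalues are orthogonal. On it \<open>T\<close> preserves orthogonality and
  \<open>\<parallel>T x\<parallel> = \<sigma>\<close>, so the normalised images form the partner family whose diagonal sum is the sum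
  of the singular values.\<close>

lemma sum_singular_values_le:
  fixes T :: "'a::complex_hilbert_space \<Rightarrow> 'b::complex_hilbert_space"
  assumes T: "bounded_clinear T" and C: "diagonal_sums_le T C"
    and S: "finite S" "S \<subseteq> {0<..}"
  shows "(\<Sum>\<sigma>\<in>S. real (singular_value_multiplicity T \<sigma>) * \<sigma>) \<le> C"
proof -
  define V where
    "V \<sigma> = {x. \<forall>y. cinner (T x) (T y) = complex_of_real (\<sigma>\<^sup>2) * cinner x y}" for \<sigma>
  have mult: "singular_value_multiplicity T \<sigma> = complex_vector.dim (V \<sigma>)" for \<sigma>
    by (simp only: singular_value_multiplicity_def V_def cadjoint_eigenspace_eq[OF T])
  have "complex_vector.subspace (V \<sigma>)" for \<sigma>
    by (rule complex_vector.subspaceI)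
      (simp_all add: V_def bounded_clinear_zero[OF T] bounded_clinear_add[OF T]
        bounded_clinear_scaleC[OF T] cinner_add_left cinner_scaleC_left algebra_simps)
  then have "\<exists>B\<subseteq>V \<sigma>. finite B \<and> card B = singular_value_multiplicity T \<sigma>
      \<and> orthonormal_on B (\<lambda>x. x)" for \<sigma>
    unfolding mult by (intro orthonormal_subset_of_subspace) auto
  then obtain B where B: "\<And>\<sigma>. B \<sigma> \<subseteq> V \<sigma>" "\<And>\<sigma>. finite (B \<sigma>)"
      "\<And>\<sigma>. card (B \<sigma>) = singular_value_multiplicity T \<sigma>"
      "\<And>\<sigma>. orthonormal_on (B \<sigma>) (\<lambda>x. x)"
    by metis
  have B_eq: "cinner (T x) (T y) = complex_of_real (\<sigma>\<^sup>2) * cinner x y" if "x \<in> B \<sigma>" for \<sigma> x y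
    using B(1)[of \<sigma>] that by (auto simp: V_def)
  have norm_T: "norm (T x) = \<sigma>" if "x \<in> B \<sigma>" "\<sigma> \<in> S" for \<sigma> x
  proof -
    have "complex_of_real ((norm (T x))\<^sup>2) = complex_of_real (\<sigma>\<^sup>2)"
      using B_eq[OF that(1), of x] orthonormal_on_norm[OF B(4) that(1)] by (simp add: cinner_self)
    then have "(norm (T x))\<^sup>2 = \<sigma>\<^sup>2" using of_real_eq_iff by blast
    then show ?thesis using that(2) S(2) by (auto simp: power2_eq_iff_nonneg less_imp_le)
  qed
  define E where "E = (\<Union>\<sigma>\<in>S. B \<sigma>)"
  define f where "f x = complex_of_real (inverse (norm (T x))) *\<^sub>C T x" for x
  have "finite E" using S(1) B(2) by (simp add: E_def)
  have onE: "cinner x y = (if x = y then 1 else 0)" if "x \<in> B \<sigma>" "y \<in> B \<tau>" "\<sigma> \<in> S" "\<tau> \<in> S" for x y \<sigma> \<tau>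
  proof (cases "\<sigma> = \<tau>")
    case True
    then show ?thesis using orthonormal_onD[OF B(4)] that by blast
  next
    case False
    \<comment> \<open>evaluate \<open>cinner (T x) (T y)\<close> by the eigenvector equation of \<open>y\<close> and by that of \<open>x\<close>\<close>
    have "complex_of_real (\<tau>\<^sup>2) * cinner x y = cnj (cinner (T y) (T x))"
      using B_eq[OF that(2), of x] cinner_commute[of x y] by simp
    also have "\<dots> = complex_of_real (\<sigma>\<^sup>2) * cinner x y"
      using B_eq[OF that(1), of y] cinner_commute[of "T x" "T y"] by simp
    finally have "cinner x y = 0 \<or> complex_of_real (\<tau>\<^sup>2) = complex_of_real (\<sigma>\<^sup>2)"
      by (simp only: mult_cancel_right)
    moreover have "complex_of_real (\<tau>\<^sup>2) \<noteq> complex_of_real (\<sigma>\<^sup>2)"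
      using False that(3,4) S(2) of_real_eq_iff[where 'a = complex, of "\<tau>\<^sup>2" "\<sigma>\<^sup>2"]
      by (auto simp: power2_eq_iff_nonneg less_imp_le subset_eq simp del: of_real_power)
    moreover have "x \<noteq> y"
      using norm_T[OF that(1,3)] norm_T[OF that(2,4)] False by auto
    ultimately show ?thesis by simp
  qed
  have "orthonormal_on E (\<lambda>x. x)"
    unfolding orthonormal_on_def E_def using onE by blast
  moreover have "orthonormal_on E f"
    unfolding orthonormal_on_def
  proof (intro ballI)
    fix x y assume "x \<in> E" "y \<in> E"
    then obtain \<sigma> \<tau> where *: "\<sigma> \<in> S" "x \<in> B \<sigma>" "\<tau> \<in> S" "y \<in> B \<tau>" by (auto simp: E_def)
    then have "\<sigma> > 0" using S(2) by auto
    have "cinner (f x) (f y) = complex_of_real (inverse (norm (T x)) * inverse (norm (T y)) * \<sigma>\<^sup>2)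
        * cinner x y"
      using B_eq[OF *(2), of y] by (simp add: f_def cinner_scaleC_left cinner_scaleC_right)
    then show "cinner (f x) (f y) = (if x = y then 1 else 0)"
      using onE[OF *(2,4,1,3)] norm_T[OF *(2,1)] \<open>\<sigma> > 0\<close>
      by (auto simp: power2_eq_square field_simps)
  qed
  ultimately have "(\<Sum>x\<in>E. cmod (cinner (T x) (f x))) \<le> C"
    using C \<open>finite E\<close> unfolding diagonal_sums_le_def by blast
  moreover have "cmod (cinner (T x) (f x)) = norm (T x)" for x
    by (cases "T x = 0") (simp_all add: f_def cinner_scaleC_right cinner_self norm_mult
        norm_inverse power2_eq_square)
  moreover have "(\<Sum>x\<in>E. norm (T x)) = (\<Sum>\<sigma>\<in>S. \<Sum>x\<in>B \<sigma>. norm (T x))"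
    unfolding E_def using S(1) B(2) norm_T by (intro sum.UNION_disjoint) blast+
  moreover have "\<dots> = (\<Sum>\<sigma>\<in>S. real (singular_value_multiplicity T \<sigma>) * \<sigma>)"
    using norm_T B(3) by (intro sum.cong) auto
  ultimately show ?thesis by simp
qed

theorem trace_class_if_diagonal_sums_le:
  fixes T :: "'a::complex_hilbert_space \<Rightarrow> 'b::complex_hilbert_space"
  assumes "bounded_clinear T" and "diagonal_sums_le T C"
  shows "trace_class T" and "trace_norm T \<le> C"
proof -
  have summable: "(\<lambda>\<sigma>. real (singular_value_multiplicity T \<sigma>) * \<sigma>) summable_on {0<..}"
    by (rule nonneg_bdd_above_summable_on)
      (auto intro!: bdd_aboveI2[where M = C] sum_singular_values_le[OF assms])
  then show "trace_class T"
    using compact_operator_if_diagonal_sums_le[OF assms] by (simp add: trace_class_def)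
  show "trace_norm T \<le> C"
    unfolding trace_norm_def
    using summable by (rule infsum_le_finite_sums) (rule sum_singular_values_le[OF assms])
qed

section \<open>Multipliers with integrable symbol\<close>

locale bounded_multiplier =
  fixes \<mu> :: "'w measure" and m :: "'w \<Rightarrow> complex"
    and F G :: "'w \<Rightarrow> 'h::complex_hilbert_space" and L\<^sub>F L\<^sub>G :: real
  assumes measurable_F: "\<And>f. (\<lambda>\<omega>. cinner f (F \<omega>)) \<in> borel_measurable \<mu>"
    and measurable_G: "\<And>f. (\<lambda>\<omega>. cinner f (G \<omega>)) \<in> borel_measurable \<mu>"
    and bound_F: "norm_bound \<mu> F L\<^sub>F" and bound_G: "norm_bound \<mu> G L\<^sub>G"
    and integrable_symbol: "integrable \<mu> m"
begin

definition bound :: real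
  where "bound = (LINT \<omega>|\<mu>. cmod (m \<omega>)) * L\<^sub>F * L\<^sub>G"

lemma bound_eq: "bound = (LINT \<omega>|\<mu>. cmod (m \<omega>) * (L\<^sub>F * L\<^sub>G))"
  by (simp add: bound_def mult.assoc)

lemma integrable_majorant: "integrable \<mu> (\<lambda>\<omega>. cmod (m \<omega>) * c)"
  using integrable_symbol by simp

text \<open>Both the integrand and the diagonal sums are \<open>\<bar>m\<bar>\<close> times some \<open>s\<close> below
  \<open>\<parallel>F \<omega>\<parallel> \<parallel>G \<omega>\<parallel>\<close>, up to a constant. The bounds \<open>L\<^sub>F\<close> and \<open>L\<^sub>G\<close> can only be
  multiplied because they dominate a norm, hence are nonnegative, at almost every point; if \<open>\<mu>\<close>
  is the zero measure they may be negative.\<close>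

lemma AE_symbol_bound:
  "AE \<omega> in \<mu>. \<forall>s. s \<le> norm (F \<omega>) * norm (G \<omega>) \<longrightarrow> cmod (m \<omega>) * s \<le> cmod (m \<omega>) * (L\<^sub>F * L\<^sub>G)"
  using bound_F bound_G unfolding norm_bound_def
proof eventually_elim
  case (elim \<omega>)
  then have "norm (F \<omega>) * norm (G \<omega>) \<le> L\<^sub>F * L\<^sub>G"
    using norm_ge_zero[of "F \<omega>"] norm_ge_zero[of "G \<omega>"] by (intro mult_mono) linarith+
  then show ?case by (auto intro!: mult_left_mono)
qed

lemma AE_integrand_le:
  "AE \<omega> in \<mu>. cmod (multiplier_integrand m F G f g \<omega>)
    \<le> cmod (m \<omega>) * (L\<^sub>F * L\<^sub>G * (norm f * norm g))"
  using AE_symbol_bound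
proof eventually_elim
  case (elim \<omega>)
  have "cmod (multiplier_integrand m F G f g \<omega>)
      = cmod (m \<omega>) * (cmod (cinner f (F \<omega>)) * cmod (cinner (G \<omega>) g))"
    by (simp add: multiplier_integrand_def norm_mult mult.assoc)
  also have "\<dots> \<le> cmod (m \<omega>) * ((norm f * norm (F \<omega>)) * (norm (G \<omega>) * norm g))"
    by (intro mult_left_mono mult_mono norm_cinner_le) auto
  also have "\<dots> = cmod (m \<omega>) * (norm (F \<omega>) * norm (G \<omega>)) * (norm f * norm g)"
    by (simp add: algebra_simps)
  also have "\<dots> \<le> cmod (m \<omega>) * (L\<^sub>F * L\<^sub>G) * (norm f * norm g)"
    using elim by (intro mult_right_mono) auto
  finally show ?case by (simp add: mult.assoc)
qed

lemma integrable_integrand: "integrable \<mu> (multiplier_integrand m F G f g)"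
proof (rule Bochner_Integration.integrable_bound)
  show "integrable \<mu> (\<lambda>\<omega>. cmod (m \<omega>) * (L\<^sub>F * L\<^sub>G * (norm f * norm g)))"
    by (rule integrable_majorant)
  have "(\<lambda>\<omega>. cnj (cinner g (G \<omega>))) \<in> borel_measurable \<mu>"
    using measurable_G by (intro borel_measurable_continuous_on[where f = cnj]) (auto intro: continuous_intros)
  moreover have "(\<lambda>\<omega>. cnj (cinner g (G \<omega>))) = (\<lambda>\<omega>. cinner (G \<omega>) g)"
    by (intro ext) (metis cinner_commute)
  ultimately have "(\<lambda>\<omega>. cinner (G \<omega>) g) \<in> borel_measurable \<mu>" by simp
  then show "multiplier_integrand m F G f g \<in> borel_measurable \<mu>"
    unfolding multiplier_integrand_def[abs_def]
    using measurable_F borel_measurable_integrable[OF integrable_symbol] by measurable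
  show "AE \<omega> in \<mu>. norm (multiplier_integrand m F G f g \<omega>)
      \<le> norm (cmod (m \<omega>) * (L\<^sub>F * L\<^sub>G * (norm f * norm g)))"
    using AE_integrand_le[of f g] by eventually_elim auto
qed

lemma norm_integral_integrand_le:
  "cmod (LINT \<omega>|\<mu>. multiplier_integrand m F G f g \<omega>) \<le> bound * norm f * norm g"
proof -
  have "cmod (LINT \<omega>|\<mu>. multiplier_integrand m F G f g \<omega>)
      \<le> (LINT \<omega>|\<mu>. cmod (m \<omega>) * (L\<^sub>F * L\<^sub>G * (norm f * norm g)))"
    by (intro order_trans[OF integral_norm_bound] integral_mono_AE integrable_norm
        integrable_integrand integrable_majorant AE_integrand_le)
  then show ?thesis by (simp add: bound_def mult.assoc)
qed

text \<open>For fixed \<open>f\<close> the defining integral is a bounded conjugate linear functional of \<open>g\<close>, and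
  the vector that represents it is the value of the operator at \<open>f\<close>.\<close>

lemma weakly_defined_operator_exists: "\<exists>T. weakly_defines \<mu> m F G T"
proof -
  have "\<exists>u. \<forall>g. cinner u g = (LINT \<omega>|\<mu>. multiplier_integrand m F G f g \<omega>)" for f
  proof (rule riesz_representation)
    show "(LINT \<omega>|\<mu>. multiplier_integrand m F G f (x + y) \<omega>)
        = (LINT \<omega>|\<mu>. multiplier_integrand m F G f x \<omega>)
          + (LINT \<omega>|\<mu>. multiplier_integrand m F G f y \<omega>)" for x y
      by (subst Bochner_Integration.integral_add[OF integrable_integrand integrable_integrand, symmetric])
        (simp add: multiplier_integrand_def[abs_def] cinner_add_right algebra_simps)
    show "(LINT \<omega>|\<mu>. multiplier_integrand m F G f (a *\<^sub>C x) \<omega>)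
        = cnj a * (LINT \<omega>|\<mu>. multiplier_integrand m F G f x \<omega>)" for a x
      by (subst integral_mult_right_zero[symmetric])
        (simp add: multiplier_integrand_def[abs_def] cinner_scaleC_right algebra_simps)
  qed (rule norm_integral_integrand_le)
  then show ?thesis unfolding weakly_defines_def by metis
qed

lemma weakly_defined_operator_unique:
  assumes "weakly_defines \<mu> m F G T" and "weakly_defines \<mu> m F G T'"
  shows "T = T'"
  by (rule ext, rule cinner_left_eqI) (use assms in \<open>simp add: weakly_defines_def\<close>)

lemma well_defined: "multiplier_well_defined \<mu> m F G"
  unfolding multiplier_well_defined_def
  using integrable_integrand weakly_defined_operator_exists weakly_defined_operator_unique by blast

lemma cinner_multiplier:
  "cinner (multiplier \<mu> m F G f) g = (LINT \<omega>|\<mu>. multiplier_integrand m F G f g \<omega>)"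
proof -
  have "\<exists>!T. weakly_defines \<mu> m F G T"
    using well_defined by (simp add: multiplier_well_defined_def)
  then have "weakly_defines \<mu> m F G (multiplier \<mu> m F G)"
    unfolding multiplier_def by (rule theI')
  then show ?thesis unfolding weakly_defines_def by blast
qed

lemma bounded_clinear_multiplier: "bounded_clinear (multiplier \<mu> m F G)"
proof (rule bounded_clinearI)
  let ?M = "multiplier \<mu> m F G"
  show "?M (x + y) = ?M x + ?M y" for x y
  proof (rule cinner_left_eqI)
    fix g
    show "cinner (?M (x + y)) g = cinner (?M x + ?M y) g"
      unfolding cinner_add_left cinner_multiplier
      by (subst Bochner_Integration.integral_add[OF integrable_integrand integrable_integrand, symmetric])
        (simp add: multiplier_integrand_def[abs_def] cinner_add_left algebra_simps)
  qed
  show "?M (a *\<^sub>C x) = a *\<^sub>C ?M x" for a x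
  proof (rule cinner_left_eqI)
    fix g
    show "cinner (?M (a *\<^sub>C x)) g = cinner (a *\<^sub>C ?M x) g"
      unfolding cinner_scaleC_left cinner_multiplier
      by (subst integral_mult_right_zero[symmetric])
        (simp add: multiplier_integrand_def[abs_def] cinner_scaleC_left algebra_simps)
  qed
  show "norm (?M x) \<le> \<bar>bound\<bar> * norm x" for x
  proof -
    have "norm (?M x) * norm (?M x) \<le> bound * norm x * norm (?M x)"
      using norm_integral_integrand_le[of x "?M x"]
      by (simp add: cinner_self norm_mult power2_eq_square flip: cinner_multiplier)
    then have "norm (?M x) \<le> \<bar>bound * norm x\<bar>"
      by (cases "?M x = 0") auto
    then show ?thesis by (simp add: abs_mult)
  qed
qed

text \<open>The finite sum is moved under the integral before estimating, so that
  \<open>sum_cinner_mult_le\<close> applies pointwise, to the vectors \<open>F \<omega>\<close> and \<open>G \<omega>\<close>.\<close>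

lemma diagonal_sums_multiplier_le: "diagonal_sums_le (multiplier \<mu> m F G) bound"
  unfolding diagonal_sums_le_def
proof (intro allI impI, elim conjE)
  fix E :: "'h set" and f :: "'h \<Rightarrow> 'h"
  assume E: "finite E" "orthonormal_on E (\<lambda>x. x)" "orthonormal_on E f"
  let ?I = "\<lambda>x \<omega>. multiplier_integrand m F G x (f x) \<omega>"
  have AE_le: "AE \<omega> in \<mu>. (\<Sum>x\<in>E. cmod (?I x \<omega>)) \<le> cmod (m \<omega>) * (L\<^sub>F * L\<^sub>G)"
    using AE_symbol_bound
  proof eventually_elim
    case (elim \<omega>)
    have "cmod (?I x \<omega>) = cmod (m \<omega>) * (cmod (cinner (F \<omega>) x) * cmod (cinner (G \<omega>) (f x)))" for x
      using cinner_commute[of x "F \<omega>"] by (simp add: multiplier_integrand_def norm_mult)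
    then show ?case
      using elim sum_cinner_mult_le[OF E, of "F \<omega>" "G \<omega>"]
      by (simp add: sum_nonneg flip: sum_distrib_left)
  qed
  have "(\<Sum>x\<in>E. cmod (cinner (multiplier \<mu> m F G x) (f x))) \<le> (\<Sum>x\<in>E. LINT \<omega>|\<mu>. cmod (?I x \<omega>))"
    unfolding cinner_multiplier by (intro sum_mono integral_norm_bound)
  also have "\<dots> = (LINT \<omega>|\<mu>. (\<Sum>x\<in>E. cmod (?I x \<omega>)))"
    by (intro Bochner_Integration.integral_sum[symmetric] integrable_norm integrable_integrand)
  also have "\<dots> \<le> bound"
    unfolding bound_eq
    by (intro integral_mono_AE AE_le integrable_majorant Bochner_Integration.integrable_sum
        integrable_norm integrable_integrand)
  finally show "(\<Sum>x\<in>E. cmod (cinner (multiplier \<mu> m F G x) (f x))) \<le> bound" .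
qed

end

theorem theorem3p10:
  fixes \<mu> :: "'w measure"
    and F G :: "'w \<Rightarrow> 'h::complex_hilbert_space"
    and m :: "'w \<Rightarrow> complex"
    and L\<^sub>F L\<^sub>G :: real
  assumes "bessel_mapping \<mu> F" and "bessel_mapping \<mu> G"
    and "norm_bound \<mu> F L\<^sub>F" and "norm_bound \<mu> G L\<^sub>G"
    and "integrable \<mu> m"
  shows "multiplier_well_defined \<mu> m F G
    \<and> bounded_clinear (multiplier \<mu> m F G)
    \<and> trace_class (multiplier \<mu> m F G)
    \<and> trace_norm (multiplier \<mu> m F G) \<le> (LINT \<omega>|\<mu>. cmod (m \<omega>)) * L\<^sub>F * L\<^sub>G"
proof -
  interpret bounded_multiplier \<mu> m F G L\<^sub>F L\<^sub>G
    using assms by unfold_locales (auto simp: bessel_mapping_def)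
  show ?thesis
    using well_defined bounded_clinear_multiplier
      trace_class_if_diagonal_sums_le[OF bounded_clinear_multiplier diagonal_sums_multiplier_le]
    by (simp add: bound_def)
qed

end
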